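(* Let $\alpha$ and $\epsilon$ be real numbers such that $|\pi-\alpha|<\epsilon<1$, and let $\alpha' = \alpha + \sin\alpha$. Then $|\pi-\alpha'|<\epsilon^3/6$.
   Context: Here $\pi=3.14159265\cdots$ is the usual mathematical constant, $\sin$ is the real sine function (argument in radians), and $\alpha$ is thought of as an approximate value of $\pi$. *)

theory Defs
  imports Complex_Main
begin

end

theory Submission
  imports Defs
begin

text \<open>
  Put \<open>\<delta> = pi - \<alpha>\<close>, the error of the approximation. The sine satisfies
  \<open>sin (pi - \<delta>) = sin \<delta>\<close>, so adding \<open>sin \<alpha>\<close> to \<open>\<alpha>\<close> turns the error \<open>\<delta>\<close> into
  \<open>\<delta> - sin \<delta>\<close>. Since the Taylor series of the sine begins with \<open>\<delta>\<close> and has no quadratic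
  term, the new error is cubic in \<open>\<delta>\<close>; the Taylor remainder of order three, controlled by
  the third derivative of the sine, gives the constant \<open>1/6\<close>.
\<close>

text \<open>
  The coefficient of \<open>x\<^sup>2\<close> vanishes, so the Taylor polynomial of degree two at the origin is
  just \<open>x\<close>, and the remainder bound of order three applies to it.
\<close>

lemma abs_x_minus_sin_le_cubic:
  fixes x :: real
  shows "\<bar>x - sin x\<bar> \<le> \<bar>x\<bar> ^ 3 / 6"
proof -
  have "(\<Sum>m<3. sin_coeff m * x ^ m) = x"
    by (simp add: eval_nat_numeral sin_coeff_def)
  then show ?thesis
    using Maclaurin_sin_bound [of x 3]
    by (simp add: abs_minus_commute fact_numeral)
qed

theorem theorem2:
  fixes \<alpha> \<alpha>' \<epsilon> :: real
  assumes "\<bar>pi - \<alpha>\<bar> < \<epsilon>" and "\<epsilon> < 1"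
    and "\<alpha>' = \<alpha> + sin \<alpha>"
  shows "\<bar>pi - \<alpha>'\<bar> < \<epsilon> ^ 3 / 6"
proof -
  have "pi - \<alpha>' = (pi - \<alpha>) - sin (pi - \<alpha>)"
    using assms(3) by simp
  then have "\<bar>pi - \<alpha>'\<bar> \<le> \<bar>pi - \<alpha>\<bar> ^ 3 / 6"
    using abs_x_minus_sin_le_cubic by presburger
  also have "\<dots> < \<epsilon> ^ 3 / 6"
    using power_strict_mono [OF assms(1), of 3] by simp
  finally show ?thesis .
qed

end
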